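(* Let $\mathbf{H}$ be a function with domain $\omega$ such that $2\le|\mathbf{H}(m)|<\omega$ for all $m$. Suppose that $h:\mathbb{R}^{\geq 0}\to\mathbb{R}^{\geq 0}$ is a non-decreasing unbounded function, that $(K,\Sigma)$ is a strongly finitary good creating pair for $\mathbf{H}$, and that $(K,\Sigma)$ is sufficiently $h$-bad. Then the forcing notion $\mathbb{Q}^*_\infty(K,\Sigma)$ collapses the continuum $\mathfrak{c}$ onto $\aleph_0$ (i.e. it forces that $2^{\omega}\cap\mathbf{V}$ is countable).
   Context: Convention: in forcing, the larger condition is the stronger one. $\mathbf{V}$ is the ground model. $\mathbf{H}$ is a function with domain $\omega$ with $2\le|\mathbf{H}(m)|<\omega$ and $0\in\mathbf{H}(m)$ for all $m$. $u\vartriangleleft v$ means that the sequence $v$ extends $u$. A creature for $\mathbf{H}$ is a triple $t=(\mathbf{nor}[t],\mathbf{val}[t],\mathbf{dis}[t])$ where $\mathbf{nor}[t]\in\mathbb{R}^{\ge0}$, $\mathbf{dis}[t]$ is hereditarily countable, and for some integers $m^t_{\rm dn}<m^t_{\rm up}<\omega$, $\emptyset\ne\mathbf{val}[t]\subseteq\{\langle u,v\rangle\in\prod_{i<m^t_{\rm dn}}\mathbf{H}(i)\times\prod_{i<m^t_{\rm up}}\mathbf{H}(i):u\vartriangleleft v\}$. The family of all creatures for $\mathbf{H}$ is $\mathrm{CR}[\mathbf{H}]$. For $K\subseteq\mathrm{CR}[\mathbf{H}]$ and $\Sigma:K\to\mathcal{P}(K)$, $(K,\Sigma)$ is a good creating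 pair for $\mathbf{H}$ if for each $t\in K$: (a) $\mathrm{dom}(\mathbf{val}[t])=\prod_{i<m^t_{\rm dn}}\mathbf{H}(i)$; (b) $t\in\Sigma(t)$, and if $s\in\Sigma(t)$ then $\mathbf{val}[s]\subseteq\mathbf{val}[t]$ (so also $m^s_{\rm dn}=m^t_{\rm dn}$, $m^s_{\rm up}=m^t_{\rm up}$); (c) if $s\in\Sigma(t)$ then $\Sigma(s)\subseteq\Sigma(t)$. It is strongly finitary if for each $i<\omega$, $|\mathbf{H}(i)|<\omega$ and $\{t\in K:m^t_{\rm dn}=i\}$ is finite. For $t_0,\dots,t_n\in K$ with $m^{t_i}_{\rm up}=m^{t_{i+1}}_{\rm dn}$ ($i<n$) and $w\in\prod_{i<m^{t_0}_{\rm dn}}\mathbf{H}(i)$, let $\mathrm{pos}(w,t_0,\dots,t_n)=\{v\in\prod_{j<m^{t_n}_{\rm up}}\mathbf{H}(j): w\vartriangleleft v\ \&\ (\forall i\le n)(\langle v\restriction m^{t_i}_{\rm dn},v\restriction m^{t_i}_{\rm up}\rangle\in\mathbf{val}[t_i])\}$. Forcing $\mathbb{Q}^*_\infty(K,\Sigma)$: conditions are sequences $p=(w^p,t^p_0,t^p_1,\dots)$ with $t^p_i\in K$, $m^{t^p_i}_{\rm up}=m^{t^p_{i+1}}_{\rm dn}$ for all $i$, $w^p\in\prod_{i<m^{t^p_0}_{\rm dn}}\mathbf{H}(i)$ and $\lim_{n\to\infty}\mathbf{nor}[t^p_n]=\infty$. Order: $p\le q$ iff for some $i<\omega$, $w^q\in\mathrm{pos}(w^p,t^p_0,\dots,t^p_{i-1})$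 (meaning $w^q=w^p$ if $i=0$) and $t^q_n\in\Sigma(t^p_{n+i})$ for all $n<\omega$. Sufficiently $h$-bad: $(K,\Sigma)$ is sufficiently $h$-bad if there are sequences $\bar m=\langle m_i:i<\omega\rangle$, $\bar A=\langle A_i:i<\omega\rangle$, $\bar F=\langle F_i:i<\omega\rangle$ such that: ($\alpha$) $\bar m$ is a strictly increasing sequence of integers, $m_0=0$, and $(\forall t\in K)(\exists i<\omega)(m^t_{\rm dn}=m_i\ \&\ m^t_{\rm up}=m_{i+1})$; ($\beta$) the $A_i$ are finite non-empty sets; ($\gamma$) $F_i=(F^0_i,F^1_i):A_i\times\prod_{m<m_{i+1}}\mathbf{H}(m)\to A_{i+1}\times2$; ($\delta$) if $i<\omega$, $t\in K$, $m^t_{\rm dn}=m_i$ and $\mathbf{nor}[t]>4$, then there is $a\in A_i$ such that for every $x\in A_{i+1}\times2$, for some $s_x\in\Sigma(t)$ we have $\mathbf{nor}[s_x]\ge\min\{h(\mathbf{nor}[t]),h(i)\}$ and $(\forall u\in\prod_{m<m_i}\mathbf{H}(m))(\forall v\in\mathrm{pos}(u,s_x))(F_i(a,v)=x)$. *)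

theory Defs
  imports Complex_Main "HOL-Library.Countable_Set_Type" "HOL-Library.Sublist"
begin

section \<open>Creatures and creating pairs\<close>

text \<open>Elements of \<open>\<Prod>i<n. H i\<close> are lists of length \<open>n\<close>; restriction \<open>v \<restriction> k\<close> is
  \<open>take k v\<close>, and ``\<open>v\<close> extends \<open>u\<close>'' is \<open>prefix u v\<close>.\<close>

definition seqs :: "(nat \<Rightarrow> 'h set) \<Rightarrow> nat \<Rightarrow> 'h list set" where
  "seqs H n = {u. length u = n \<and> (\<forall>i<n. u ! i \<in> H i)}"

text \<open>The hereditarily countable sets.\<close>

datatype hc = HC "hc cset"

record 'h creature =
  nor :: real
  val :: "('h list \<times> 'h list) set"
  dis :: hc

definition CR :: "(nat \<Rightarrow> 'h set) \<Rightarrow> 'h creature set" where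
  "CR H = {t. nor t \<ge> 0 \<and> val t \<noteq> {} \<and>
     (\<exists>dn up. dn < up \<and>
        val t \<subseteq> {(u, v). u \<in> seqs H dn \<and> v \<in> seqs H up \<and> prefix u v})}"

text \<open>For a creature \<open>t\<close> the two levels are determined by \<open>val t\<close>, because \<open>val t\<close> is
  nonempty.\<close>

definition m_dn :: "'h creature \<Rightarrow> nat" where
  "m_dn t = (THE n. \<forall>(u, v) \<in> val t. length u = n)"

definition m_up :: "'h creature \<Rightarrow> nat" where
  "m_up t = (THE n. \<forall>(u, v) \<in> val t. length v = n)"

definition good_creating_pair ::
  "(nat \<Rightarrow> 'h set) \<Rightarrow> 'h creature set \<Rightarrow> ('h creature \<Rightarrow> 'h creature set) \<Rightarrow> bool" where
  "good_creating_pair H K \<Sigma> \<longleftrightarrow>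
     K \<subseteq> CR H \<and> (\<forall>t\<in>K. \<Sigma> t \<subseteq> K) \<and>
     (\<forall>t\<in>K.
        Domain (val t) = seqs H (m_dn t) \<and>
        t \<in> \<Sigma> t \<and> (\<forall>s\<in>\<Sigma> t. val s \<subseteq> val t) \<and>
        (\<forall>s\<in>\<Sigma> t. \<Sigma> s \<subseteq> \<Sigma> t))"

definition strongly_finitary :: "(nat \<Rightarrow> 'h set) \<Rightarrow> 'h creature set \<Rightarrow> bool" where
  "strongly_finitary H K \<longleftrightarrow> (\<forall>i. finite (H i) \<and> finite {t \<in> K. m_dn t = i})"

text \<open>\<open>pos H w []\<close> is \<open>{w}\<close>, which is the convention for \<open>i = 0\<close> in the order below.\<close>

definition pos ::
  "(nat \<Rightarrow> 'h set) \<Rightarrow> 'h list \<Rightarrow> 'h creature list \<Rightarrow> 'h list set" where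
  "pos H w ts = (if ts = [] then {w} else
     {v \<in> seqs H (m_up (last ts)).
        prefix w v \<and> (\<forall>t\<in>set ts. (take (m_dn t) v, take (m_up t) v) \<in> val t)})"


section \<open>The forcing notion\<close>

type_synonym 'h condition = "'h list \<times> (nat \<Rightarrow> 'h creature)"

definition Qinf :: "(nat \<Rightarrow> 'h set) \<Rightarrow> 'h creature set \<Rightarrow> 'h condition set" where
  "Qinf H K = {(w, t).
     (\<forall>i. t i \<in> K) \<and> (\<forall>i. m_up (t i) = m_dn (t (Suc i))) \<and>
     w \<in> seqs H (m_dn (t 0)) \<and>
     filterlim (\<lambda>n. nor (t n)) at_top sequentially}"

text \<open>The larger condition is the stronger one.\<close>

definition Qinf_le ::
  "(nat \<Rightarrow> 'h set) \<Rightarrow> ('h creature \<Rightarrow> 'h creature set) \<Rightarrow>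
   'h condition \<Rightarrow> 'h condition \<Rightarrow> bool" where
  "Qinf_le H \<Sigma> p q \<longleftrightarrow>
     (\<exists>i. fst q \<in> pos H (fst p) (map (snd p) [0..<i]) \<and>
          (\<forall>n. snd q n \<in> \<Sigma> (snd p (n + i))))"


section \<open>Sufficient badness\<close>

text \<open>The type argument is the type of the elements of the finite sets \<open>A i\<close>;
  the two-element set \<open>2\<close> is \<^typ>\<open>bool\<close>.\<close>

definition sufficiently_bad ::
  "'a itself \<Rightarrow> (real \<Rightarrow> real) \<Rightarrow> (nat \<Rightarrow> 'h set) \<Rightarrow> 'h creature set \<Rightarrow>
   ('h creature \<Rightarrow> 'h creature set) \<Rightarrow> bool" where
  "sufficiently_bad _ h H K \<Sigma> \<longleftrightarrow>
     (\<exists>(m :: nat \<Rightarrow> nat) (A :: nat \<Rightarrow> 'a set) (F :: nat \<Rightarrow> 'a \<Rightarrow> 'h list \<Rightarrow> 'a \<times> bool).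
        strict_mono m \<and> m 0 = 0 \<and>
        (\<forall>t\<in>K. \<exists>i. m_dn t = m i \<and> m_up t = m (Suc i)) \<and>
        (\<forall>i. finite (A i) \<and> A i \<noteq> {}) \<and>
        (\<forall>i. \<forall>a\<in>A i. \<forall>v\<in>seqs H (m (Suc i)). F i a v \<in> A (Suc i) \<times> UNIV) \<and>
        (\<forall>i. \<forall>t\<in>K. m_dn t = m i \<and> nor t > 4 \<longrightarrow>
           (\<exists>a\<in>A i. \<forall>x \<in> A (Suc i) \<times> UNIV. \<exists>s\<in>\<Sigma> t.
              nor s \<ge> min (h (nor t)) (h (real i)) \<and>
              (\<forall>u\<in>seqs H (m i). \<forall>v\<in>pos H u [s]. F i a v = x))))"


section \<open>The forcing relation\<close>

text \<open>The ground model is the HOL universe. A sentence of the forcing language is represented by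
  the predicate ``\<open>p\<close> forces it''. The clauses are the usual recursive ones, for an arbitrary
  carrier \<open>P\<close> and order \<open>le\<close> in which larger conditions are stronger.

  A name for a subset of the ground-model set \<open>B\<close> is a set of pairs \<open>(x, s)\<close> with
  \<open>x \<in> B\<close>, \<open>s \<in> P\<close>; its interpretation by a generic filter \<open>G\<close> is
  \<open>{x. \<exists>s\<in>G. (x, s) \<in> \<tau>}\<close>. Every subset of \<open>B\<close> in the extension has such a name.\<close>

locale forcing =
  fixes P :: "'p set" and le :: "'p \<Rightarrow> 'p \<Rightarrow> bool"
begin

definition dense_above :: "'p \<Rightarrow> 'p set \<Rightarrow> bool" where
  "dense_above p D \<longleftrightarrow> (\<forall>q\<in>P. le p q \<longrightarrow> (\<exists>r\<in>P. le q r \<and> r \<in> D))"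

definition names :: "'b set \<Rightarrow> ('b \<times> 'p) set set" where
  "names B = Pow (B \<times> P)"

definition fMem :: "'b \<Rightarrow> ('b \<times> 'p) set \<Rightarrow> 'p \<Rightarrow> bool" where
  "fMem x \<tau> p \<longleftrightarrow> dense_above p {q. \<exists>s. (x, s) \<in> \<tau> \<and> le s q}"

definition fEq :: "'b \<Rightarrow> 'b \<Rightarrow> 'p \<Rightarrow> bool" \<comment> \<open>between ground-model elements\<close> where
  "fEq x y p \<longleftrightarrow> x = y"

definition fConj :: "('p \<Rightarrow> bool) \<Rightarrow> ('p \<Rightarrow> bool) \<Rightarrow> 'p \<Rightarrow> bool" where
  "fConj \<phi> \<psi> p \<longleftrightarrow> \<phi> p \<and> \<psi> p"

definition fNeg :: "('p \<Rightarrow> bool) \<Rightarrow> 'p \<Rightarrow> bool" where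
  "fNeg \<phi> p \<longleftrightarrow> (\<forall>q\<in>P. le p q \<longrightarrow> \<not> \<phi> q)"

definition fImp :: "('p \<Rightarrow> bool) \<Rightarrow> ('p \<Rightarrow> bool) \<Rightarrow> 'p \<Rightarrow> bool" where
  "fImp \<phi> \<psi> = fNeg (fConj \<phi> (fNeg \<psi>))"

text \<open>The range \<open>D\<close> of a quantifier is a ground-model set or a set of names.\<close>

definition fAll :: "'d set \<Rightarrow> ('d \<Rightarrow> 'p \<Rightarrow> bool) \<Rightarrow> 'p \<Rightarrow> bool" where
  "fAll D \<phi> p \<longleftrightarrow> (\<forall>x\<in>D. \<phi> x p)"

definition fEx :: "'d set \<Rightarrow> ('d \<Rightarrow> 'p \<Rightarrow> bool) \<Rightarrow> 'p \<Rightarrow> bool" where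
  "fEx D \<phi> p \<longleftrightarrow> dense_above p {q. \<exists>x\<in>D. \<phi> x q}"

text \<open>``\<open>f\<close> is a function from \<open>A\<close> onto \<open>B\<close>'', for ground-model sets \<open>A\<close>, \<open>B\<close> and a name \<open>f\<close>
  of a subset of \<open>A \<times> B\<close>.\<close>

definition fFunction :: "'a set \<Rightarrow> 'b set \<Rightarrow> (('a \<times> 'b) \<times> 'p) set \<Rightarrow> 'p \<Rightarrow> bool" where
  "fFunction A B f = fConj
     (fAll A (\<lambda>x. fEx B (\<lambda>y. fMem (x, y) f)))
     (fAll A (\<lambda>x. fAll B (\<lambda>y. fAll B (\<lambda>z.
        fImp (fConj (fMem (x, y) f) (fMem (x, z) f)) (fEq y z)))))"

definition fOnto :: "'a set \<Rightarrow> 'b set \<Rightarrow> (('a \<times> 'b) \<times> 'p) set \<Rightarrow> 'p \<Rightarrow> bool" where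
  "fOnto A B f = fConj (fFunction A B f) (fAll B (\<lambda>y. fEx A (\<lambda>x. fMem (x, y) f)))"

text \<open>Every condition forces that there is a function from \<open>\<omega>\<close> onto the set \<open>2\<^sup>\<omega>\<close> of the ground
  model.\<close>

definition collapses_continuum :: bool where
  "collapses_continuum \<longleftrightarrow>
     (\<forall>p\<in>P. fEx (names (UNIV \<times> UNIV))
        (fOnto (UNIV :: nat set) (UNIV :: (nat \<Rightarrow> bool) set)) p)"

end

end

theory Submission
  imports Defs
begin

text \<open>The generic filter yields a branch \<open>W\<close> through \<open>\<Prod>i. H i\<close>. Started at level \<open>i\<close> in a state
  \<open>a \<in> A i\<close>, the functions \<open>F\<close> read \<open>W\<close> and produce a sequence of bits; there are only countably many
  pairs \<open>(i, a)\<close>. Given a condition whose creatures have norm above 4 and a ground-model sequence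
  \<open>y\<close>, badness first supplies a state for every creature, and then lets us shrink each creature so
  that \<open>F\<close> moves from its state to that of the next creature while emitting the next bit of \<open>y\<close>.
  So every \<open>y\<close> is densely often the output of some \<open>(i, a)\<close>.\<close>

section \<open>Collapsing by partially decided values\<close>

text \<open>\<open>R n y p\<close> plays the role of ``\<open>p\<close> forces the \<open>n\<close>-th value to be \<open>y\<close>''. The \<open>n\<close>-th value may
  fail to lie in the ground model; the name below then takes a default value.\<close>

lemma (in forcing) collapses_continuumI:
  fixes R :: "nat \<Rightarrow> (nat \<Rightarrow> bool) \<Rightarrow> 'p \<Rightarrow> bool"
  assumes refl: "\<And>p. p \<in> P \<Longrightarrow> le p p"
    and trans: "\<And>p q r. p \<in> P \<Longrightarrow> q \<in> P \<Longrightarrow> r \<in> P \<Longrightarrow> le p q \<Longrightarrow> le q r \<Longrightarrow> le p r"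
    and mono: "\<And>n y p q. p \<in> P \<Longrightarrow> q \<in> P \<Longrightarrow> le p q \<Longrightarrow> R n y p \<Longrightarrow> R n y q"
    and unique: "\<And>n y z p. p \<in> P \<Longrightarrow> R n y p \<Longrightarrow> R n z p \<Longrightarrow> y = z"
    and onto: "\<And>y p. p \<in> P \<Longrightarrow> \<exists>q\<in>P. le p q \<and> (\<exists>n. R n y q)"
  shows collapses_continuum
proof -
  define dflt :: "nat \<Rightarrow> bool" where "dflt = (\<lambda>_. False)"
  \<comment> \<open>Each condition is \<open>undecided n\<close> or has an extension that satisfies
    \<open>R n y\<close> for some \<open>y\<close>. Giving undecided conditions the value
    \<open>dflt\<close> thus makes \<open>f\<close> total on a dense set.\<close>
  define undecided where
    "undecided n q \<longleftrightarrow> (\<forall>r\<in>P. le q r \<longrightarrow> (\<forall>y. \<not> R n y r))" for n q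
  define f where
    "f = {((n, y), q). q \<in> P \<and> (R n y q \<or> undecided n q \<and> y = dflt)}"
  have f_names: "f \<in> names (UNIV \<times> UNIV)"
    by (auto simp: f_def names_def)
  have fMemI: "fMem (n, y) f q" if "((n, y), q) \<in> f" for n y q
  proof -
    have "q \<in> P" using that by (simp add: f_def)
    then show ?thesis
      unfolding fMem_def dense_above_def using that refl by blast
  qed
  have fMem_unique: "y = z" if q: "q \<in> P" and y: "fMem (n, y) f q" and z: "fMem (n, z) f q"
    for n y z q
  proof -
    obtain r s where r: "r \<in> P" "le q r" and s: "((n, y), s) \<in> f" "le s r"
      using q y refl unfolding fMem_def dense_above_def by blast
    obtain r' s' where r': "r' \<in> P" "le r r'" and s': "((n, z), s') \<in> f" "le s' r'"
      using z r unfolding fMem_def dense_above_def by blast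
    have P: "s \<in> P" "s' \<in> P" using s s' by (auto simp: f_def)
    have sr': "le s r'" using trans[OF P(1) r(1) r'(1) s(2) r'(2)] .
    \<comment> \<open>Both witnesses lie below \<open>r'\<close>. An undecided one has no extension
      satisfying \<open>R\<close>, so the mixed cases are impossible; otherwise both values hold at
      \<open>r'\<close> or both are \<open>dflt\<close>.\<close>
    have 1: "R n y r' \<or> undecided n s \<and> y = dflt"
      using s P mono[OF P(1) r'(1) sr'] by (auto simp: f_def)
    have 2: "R n z r' \<or> undecided n s' \<and> z = dflt"
      using s' P mono[OF P(2) r'(1) s'(2)] by (auto simp: f_def)
    show "y = z"
      using 1 2 unique[OF r'(1)] sr' s'(2) r'(1) unfolding undecided_def by blast
  qed
  have "fOnto UNIV UNIV f p" if "p \<in> P" for p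
    unfolding fOnto_def fFunction_def fConj_def fAll_def fEx_def
  proof (intro conjI ballI)
    fix n
    show "dense_above p {q. \<exists>y\<in>UNIV. fMem (n, y) f q}"
      unfolding dense_above_def
    proof (intro ballI impI)
      fix q assume q: "q \<in> P" "le p q"
      show "\<exists>r\<in>P. le q r \<and> r \<in> {q. \<exists>y\<in>UNIV. fMem (n, y) f q}"
      proof (cases "undecided n q")
        case True
        then have "((n, dflt), q) \<in> f" using q by (simp add: f_def)
        then show ?thesis using fMemI q refl by blast
      next
        case False
        then obtain r y where "r \<in> P" "le q r" "((n, y), r) \<in> f"
          unfolding undecided_def f_def by blast
        then show ?thesis using fMemI by blast
      qed
    qed
  next
    fix n y z
    show "fImp (\<lambda>p. fMem (n, y) f p \<and> fMem (n, z) f p) (fEq y z) p"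
      unfolding fImp_def fNeg_def fConj_def fEq_def using fMem_unique refl by blast
  next
    fix y
    show "dense_above p {q. \<exists>x\<in>UNIV. fMem (x, y) f q}"
      unfolding dense_above_def
    proof (intro ballI impI)
      fix q assume "q \<in> P" "le p q"
      obtain r n where "r \<in> P" "le q r" "R n y r" using onto[OF \<open>q \<in> P\<close>] by blast
      moreover from this have "fMem (n, y) f r" by (intro fMemI) (simp add: f_def)
      ultimately show "\<exists>r\<in>P. le q r \<and> r \<in> {q. \<exists>x\<in>UNIV. fMem (x, y) f q}" by blast
    qed
  qed
  then show ?thesis
    unfolding collapses_continuum_def fEx_def dense_above_def using f_names refl by blast
qed

section \<open>Good creating pairs\<close>

text \<open>A single pair in \<open>val t\<close> fixes both lengths, so the definite descriptions
  \<open>m_dn\<close> and \<open>m_up\<close> denote the bounds occurring in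
  \<open>CR\<close>.\<close>

lemma CR_val:
  assumes "t \<in> CR H" "(u, v) \<in> val t"
  shows "u \<in> seqs H (m_dn t)" "v \<in> seqs H (m_up t)" "prefix u v"
    and m_dn_less_m_up: "m_dn t < m_up t"
proof -
  obtain dn up where du: "dn < up"
    "val t \<subseteq> {(u, v). u \<in> seqs H dn \<and> v \<in> seqs H up \<and> prefix u v}"
    using assms(1) unfolding CR_def by blast
  have "m_dn t = dn"
    unfolding m_dn_def using du assms(2) by (intro the_equality) (auto simp: seqs_def)
  moreover have "m_up t = up"
    unfolding m_up_def using du assms(2) by (intro the_equality) (auto simp: seqs_def)
  ultimately show "u \<in> seqs H (m_dn t)" "v \<in> seqs H (m_up t)" "prefix u v" "m_dn t < m_up t"
    using du assms(2) by auto
qed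

lemma prefix_take_eq: "prefix u v \<Longrightarrow> k \<le> length u \<Longrightarrow> take k v = take k u"
  by (auto simp: prefix_def)

locale creating_pair =
  fixes H :: "nat \<Rightarrow> 'h set" and K \<Sigma>
  assumes good: "good_creating_pair H K \<Sigma>"
begin

lemma K_CR: "t \<in> K \<Longrightarrow> t \<in> CR H"
  and Sigma_K: "t \<in> K \<Longrightarrow> s \<in> \<Sigma> t \<Longrightarrow> s \<in> K"
  and Domain_val: "t \<in> K \<Longrightarrow> Domain (val t) = seqs H (m_dn t)"
  and Sigma_refl: "t \<in> K \<Longrightarrow> t \<in> \<Sigma> t"
  and Sigma_val: "t \<in> K \<Longrightarrow> s \<in> \<Sigma> t \<Longrightarrow> val s \<subseteq> val t"
  and Sigma_trans: "t \<in> K \<Longrightarrow> s \<in> \<Sigma> t \<Longrightarrow> \<Sigma> s \<subseteq> \<Sigma> t"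
  using good unfolding good_creating_pair_def by blast+

lemma K_val:
  assumes "t \<in> K"
  obtains u v where "(u, v) \<in> val t"
  using K_CR[OF assms] unfolding CR_def by auto

lemma K_less: "t \<in> K \<Longrightarrow> m_dn t < m_up t"
  by (meson K_CR K_val m_dn_less_m_up)

text \<open>Any pair in \<open>val s\<close> also lies in \<open>val t\<close>, and its two lengths
  are the levels of both creatures.\<close>

lemma Sigma_levels:
  assumes "t \<in> K" "s \<in> \<Sigma> t"
  shows "m_dn s = m_dn t" "m_up s = m_up t"
proof -
  have s: "s \<in> K" using Sigma_K assms by blast
  obtain u v where s_uv: "(u, v) \<in> val s" using K_val[OF s] .
  then have t_uv: "(u, v) \<in> val t" using Sigma_val assms by blast
  show "m_dn s = m_dn t" "m_up s = m_up t"
    using CR_val[OF K_CR[OF s] s_uv] CR_val[OF K_CR[OF assms(1)] t_uv]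
    by (simp_all add: seqs_def)
qed

section \<open>Conditions and their order\<close>

lemma QinfD:
  assumes "p \<in> Qinf H K"
  shows "snd p i \<in> K" "m_up (snd p i) = m_dn (snd p (Suc i))"
    "fst p \<in> seqs H (m_dn (snd p 0))" "filterlim (\<lambda>n. nor (snd p n)) at_top sequentially"
  using assms by (auto simp: Qinf_def)

lemma Qinf_m_dn_strict_mono:
  assumes "p \<in> Qinf H K"
  shows "strict_mono (\<lambda>i. m_dn (snd p i))"
  unfolding strict_mono_Suc_iff
  using K_less[OF QinfD(1)[OF assms]] QinfD(2)[OF assms] by metis

lemma Qinf_m_dn_mono:
  assumes "p \<in> Qinf H K" "i \<le> j"
  shows "m_dn (snd p i) \<le> m_dn (snd p j)"
  using strict_mono_less_eq[OF Qinf_m_dn_strict_mono[OF assms(1)]] assms(2) by blast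

text \<open>For \<open>n = 0\<close> length and prefix already force \<open>v = fst p\<close>, so
  the special clause for the empty list disappears and all \<open>n\<close> are treated
  alike.\<close>

lemma pos_iff:
  assumes p: "p \<in> Qinf H K"
  shows "v \<in> pos H (fst p) (map (snd p) [0..<n]) \<longleftrightarrow>
    v \<in> seqs H (m_dn (snd p n)) \<and> prefix (fst p) v \<and>
    (\<forall>j<n. (take (m_dn (snd p j)) v, take (m_dn (snd p (Suc j))) v) \<in> val (snd p j))"
proof (cases n)
  case 0
  have "fst p = v" if "v \<in> seqs H (m_dn (snd p 0))" "prefix (fst p) v"
    using that QinfD(3)[OF p] by (auto simp: seqs_def prefix_def)
  then show ?thesis using 0 QinfD(3)[OF p] by (auto simp: pos_def)
next
  case (Suc k)
  then show ?thesis using QinfD(2)[OF p] by (auto simp: pos_def less_Suc_eq)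
qed

lemma Qinf_le_iff:
  assumes "p \<in> Qinf H K"
  shows "Qinf_le H \<Sigma> p q \<longleftrightarrow>
    (\<exists>i. fst q \<in> seqs H (m_dn (snd p i)) \<and> prefix (fst p) (fst q) \<and>
      (\<forall>j<i. (take (m_dn (snd p j)) (fst q), take (m_dn (snd p (Suc j))) (fst q))
        \<in> val (snd p j)) \<and>
      (\<forall>n. snd q n \<in> \<Sigma> (snd p (n + i))))"
  unfolding Qinf_le_def pos_iff[OF assms] by (simp add: conj_assoc)

lemma Qinf_le_refl: "p \<in> Qinf H K \<Longrightarrow> Qinf_le H \<Sigma> p p"
  by (subst Qinf_le_iff; auto intro!: exI[of _ 0] simp: QinfD Sigma_refl)

text \<open>The offsets \<open>i\<close> and \<open>k\<close> add. Below offset \<open>i\<close> the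
  stem of \<open>r\<close> agrees with that of \<open>q\<close>; beyond it, the creatures of
  \<open>q\<close> have smaller \<open>val\<close> than those of \<open>p\<close>.\<close>

lemma Qinf_le_trans:
  assumes p: "p \<in> Qinf H K" and q: "q \<in> Qinf H K"
    and pq: "Qinf_le H \<Sigma> p q" and qr: "Qinf_le H \<Sigma> q r"
  shows "Qinf_le H \<Sigma> p r"
proof -
  obtain i where i: "fst q \<in> seqs H (m_dn (snd p i))" "prefix (fst p) (fst q)"
    "\<And>j. j < i \<Longrightarrow>
      (take (m_dn (snd p j)) (fst q), take (m_dn (snd p (Suc j))) (fst q)) \<in> val (snd p j)"
    "\<And>n. snd q n \<in> \<Sigma> (snd p (n + i))"
    using pq[unfolded Qinf_le_iff[OF p]] by blast
  obtain k where k: "fst r \<in> seqs H (m_dn (snd q k))" "prefix (fst q) (fst r)"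
    "\<And>j. j < k \<Longrightarrow>
      (take (m_dn (snd q j)) (fst r), take (m_dn (snd q (Suc j))) (fst r)) \<in> val (snd q j)"
    "\<And>n. snd r n \<in> \<Sigma> (snd q (n + k))"
    using qr[unfolded Qinf_le_iff[OF q]] by blast
  have dn: "m_dn (snd q n) = m_dn (snd p (n + i))" for n
    using Sigma_levels[OF QinfD(1)[OF p] i(4)] by blast
  show ?thesis
  unfolding Qinf_le_iff[OF p]
  proof (intro exI[of _ "k + i"] conjI allI impI)
    show "fst r \<in> seqs H (m_dn (snd p (k + i)))" using k(1) dn by simp
    show "prefix (fst p) (fst r)" using i(2) k(2) by (rule prefix_order.trans)
    show "snd r n \<in> \<Sigma> (snd p (n + (k + i)))" for n
      using k(4)[of n] i(4)[of "n + k"] Sigma_trans[OF QinfD(1)[OF p]] by (force simp: add.assoc)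
    fix j assume j: "j < k + i"
    show "(take (m_dn (snd p j)) (fst r), take (m_dn (snd p (Suc j))) (fst r)) \<in> val (snd p j)"
    proof (cases "j < i")
      case True
      have "length (fst q) = m_dn (snd p i)" using i(1) by (simp add: seqs_def)
      then have "l \<le> i \<Longrightarrow> take (m_dn (snd p l)) (fst r) = take (m_dn (snd p l)) (fst q)" for l
        using prefix_take_eq[OF k(2)] Qinf_m_dn_mono[OF p] by metis
      then show ?thesis using i(3)[OF True] True by simp
    next
      case False
      then have "j - i < k" "j - i + i = j" using j by auto
      then show ?thesis
        using k(3)[of "j - i"] dn[of "j - i"] dn[of "Suc (j - i)"] i(4)[of "j - i"]
          Sigma_val[OF QinfD(1)[OF p]] by auto
    qed
  qed
qed

section \<open>Construction of stronger conditions\<close>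

text \<open>Since the domain of \<open>val\<close> is the full product, a stem can be continued
  through one creature after another.\<close>

lemma pos_nonempty:
  assumes p: "p \<in> Qinf H K"
  shows "\<exists>v. v \<in> pos H (fst p) (map (snd p) [0..<n])"
proof (induction n)
  case 0
  show ?case by (simp add: pos_def)
next
  case (Suc n)
  then obtain u where u: "u \<in> seqs H (m_dn (snd p n))" "prefix (fst p) u"
    "\<And>j. j < n \<Longrightarrow> (take (m_dn (snd p j)) u, take (m_dn (snd p (Suc j))) u) \<in> val (snd p j)"
    unfolding pos_iff[OF p] by blast
  obtain v where v: "(u, v) \<in> val (snd p n)"
    using Domain_val[OF QinfD(1)[OF p, of n]] u(1) by blast
  note uv = CR_val[OF K_CR[OF QinfD(1)[OF p]] v]
  have len: "length u = m_dn (snd p n)" "length v = m_dn (snd p (Suc n))"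
    using uv(1,2) QinfD(2)[OF p] by (auto simp: seqs_def)
  have take: "take (m_dn (snd p l)) v = take (m_dn (snd p l)) u" if "l \<le> n" for l
    using prefix_take_eq[OF uv(3)] Qinf_m_dn_mono[OF p that] len(1) by metis
  have "(take (m_dn (snd p j)) v, take (m_dn (snd p (Suc j))) v) \<in> val (snd p j)"
    if "j < Suc n" for j
  proof (cases "j = n")
    case True
    then show ?thesis using v len take[of n] by simp
  next
    case False
    then show ?thesis using that u(3)[of j] take by simp
  qed
  then have "v \<in> pos H (fst p) (map (snd p) [0..<Suc n])"
    unfolding pos_iff[OF p] using uv(2,3) u(2) QinfD(2)[OF p] prefix_order.trans by metis
  then show ?case ..
qed

text \<open>Shrinking via \<open>\<Sigma>\<close> keeps the levels, so the creatures still fit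
  together; only the growth of the norms has to be supplied.\<close>

lemma Qinf_pure_extension:
  assumes p: "p \<in> Qinf H K"
    and w: "w \<in> pos H (fst p) (map (snd p) [0..<n])"
    and s: "\<And>k. s k \<in> \<Sigma> (snd p (k + n))"
    and lim: "filterlim (\<lambda>k. nor (s k)) at_top sequentially"
  shows "(w, s) \<in> Qinf H K" "Qinf_le H \<Sigma> p (w, s)"
proof -
  have "s k \<in> K" "m_dn (s k) = m_dn (snd p (k + n))" "m_up (s k) = m_up (snd p (k + n))" for k
    using s Sigma_K Sigma_levels QinfD(1)[OF p] by blast+
  moreover have "w \<in> seqs H (m_dn (snd p n))" using w pos_iff[OF p] by blast
  ultimately show "(w, s) \<in> Qinf H K"
    using lim QinfD(2)[OF p] by (simp add: Qinf_def)
  show "Qinf_le H \<Sigma> p (w, s)" using w s by (auto simp: Qinf_le_def)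
qed

text \<open>Push the stem through \<open>n\<close> creatures: the levels increase strictly, so the
  \<open>n\<close>-th is at least \<open>n\<close>.\<close>

lemma ex_long_extension:
  assumes p: "p \<in> Qinf H K"
  shows "\<exists>q\<in>Qinf H K. Qinf_le H \<Sigma> p q \<and> n \<le> length (fst q)"
proof -
  obtain v where v: "v \<in> pos H (fst p) (map (snd p) [0..<n])" using pos_nonempty[OF p] by blast
  have "filterlim (\<lambda>k. nor (snd p (k + n))) at_top sequentially"
    using filterlim_compose[OF QinfD(4)[OF p] filterlim_add_const_nat_at_top] .
  note q = Qinf_pure_extension[OF p v Sigma_refl[OF QinfD(1)[OF p]] this]
  have "length v = m_dn (snd p n)" using v pos_iff[OF p] by (simp add: seqs_def)
  moreover have "n \<le> m_dn (snd p n)"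
    using strict_mono_imp_increasing[OF Qinf_m_dn_strict_mono[OF p]] by blast
  ultimately show ?thesis using q by (intro bexI[OF _ q(1)]) simp
qed

end

section \<open>The sequences read off the generic branch\<close>

text \<open>A run of the automaton \<open>F\<close> along the branch approximated by
  \<open>w\<close>, started at level \<open>i\<close> in state \<open>a\<close>. Step
  \<open>n\<close> is meaningful only if \<open>w\<close> has length at least
  \<open>m (Suc (i + n))\<close>; a shorter \<open>w\<close> is read truncated.\<close>

fun state :: "(nat \<Rightarrow> 'a \<Rightarrow> 'h list \<Rightarrow> 'a \<times> bool) \<Rightarrow> (nat \<Rightarrow> nat) \<Rightarrow> nat \<Rightarrow> 'a \<Rightarrow> 'h list \<Rightarrow> nat \<Rightarrow> 'a"
  where
    "state F m i a w 0 = a"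
  | "state F m i a w (Suc n) = fst (F (i + n) (state F m i a w n) (take (m (Suc (i + n))) w))"

definition bit ::
  "(nat \<Rightarrow> 'a \<Rightarrow> 'h list \<Rightarrow> 'a \<times> bool) \<Rightarrow> (nat \<Rightarrow> nat) \<Rightarrow> nat \<Rightarrow> 'a \<Rightarrow> 'h list \<Rightarrow> nat \<Rightarrow> bool" where
  "bit F m i a w n = snd (F (i + n) (state F m i a w n) (take (m (Suc (i + n))) w))"

lemma mono_unbounded_at_top:
  fixes h :: "real \<Rightarrow> real"
  assumes "mono_on {0..} h" "\<not> bdd_above (h ` {0..})"
  shows "filterlim h at_top at_top"
  unfolding filterlim_at_top
proof
  fix Z
  obtain x where "x \<ge> 0" "Z < h x"
    using assms(2) unfolding bdd_above_def by (auto simp: not_le)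
  then have "Z \<le> h y" if "y \<ge> x" for y
    using mono_onD[OF assms(1), of x y] that by auto
  then show "eventually (\<lambda>y. Z \<le> h y) at_top" by (rule eventually_at_top_linorderI)
qed

theorem proposition2p2:
  fixes H :: "nat \<Rightarrow> 'h::zero set"
    and h :: "real \<Rightarrow> real"
    and K :: "'h creature set"
    and \<Sigma> :: "'h creature \<Rightarrow> 'h creature set"
  assumes "\<And>m. finite (H m) \<and> 2 \<le> card (H m) \<and> 0 \<in> H m"
    and "\<And>x. 0 \<le> x \<Longrightarrow> 0 \<le> h x"
    and "mono_on {0..} h"
    and "\<not> bdd_above (h ` {0..})"
    and "good_creating_pair H K \<Sigma>"
    and "strongly_finitary H K"
    and "sufficiently_bad TYPE('a) h H K \<Sigma>"
  shows "forcing.collapses_continuum (Qinf H K) (Qinf_le H \<Sigma>)"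
proof -
  interpret creating_pair H K \<Sigma> by unfold_locales fact
  obtain m :: "nat \<Rightarrow> nat" and A :: "nat \<Rightarrow> 'a set" and F :: "nat \<Rightarrow> 'a \<Rightarrow> 'h list \<Rightarrow> 'a \<times> bool"
    where m: "strict_mono m"
      and levels: "\<forall>t\<in>K. \<exists>i. m_dn t = m i \<and> m_up t = m (Suc i)"
      and A: "\<forall>i. finite (A i) \<and> A i \<noteq> {}"
      and bad: "\<forall>i. \<forall>t\<in>K. m_dn t = m i \<and> nor t > 4 \<longrightarrow>
         (\<exists>a\<in>A i. \<forall>x \<in> A (Suc i) \<times> UNIV. \<exists>s\<in>\<Sigma> t.
              nor s \<ge> min (h (nor t)) (h (real i)) \<and>
              (\<forall>u\<in>seqs H (m i). \<forall>v\<in>pos H u [s]. F i a v = x))"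
    using assms(7) unfolding sufficiently_bad_def
    by (elim exE conjE) (rule that, assumption+)
  define I where "I = Sigma UNIV A"
  have I_countable: "countable I"
    unfolding I_def using A by (intro countable_SIGMA) (auto simp: countable_finite)
  \<comment> \<open>The \<open>n\<close>-th start outputs \<open>y\<close> along every stem that a
    stronger condition can have. The length guard keeps only bits that the stem determines;
    quantifying over all stronger \<open>r\<close> makes \<open>R\<close> monotone.\<close>
  define R where "R n y q \<longleftrightarrow> (case from_nat_into I n of (i, a) \<Rightarrow>
      \<forall>r\<in>Qinf H K. Qinf_le H \<Sigma> q r \<longrightarrow>
        (\<forall>k. m (Suc (i + k)) \<le> length (fst r) \<longrightarrow> bit F m i a (fst r) k = y k))" for n y q
  show ?thesis
  proof (rule forcing.collapses_continuumI[where R = R])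
    fix p q r assume "p \<in> Qinf H K" "q \<in> Qinf H K" "r \<in> Qinf H K"
      "Qinf_le H \<Sigma> p q" "Qinf_le H \<Sigma> q r"
    then show "Qinf_le H \<Sigma> p r" by (blast intro: Qinf_le_trans)
  next
    fix n y p q assume "p \<in> Qinf H K" "q \<in> Qinf H K" "Qinf_le H \<Sigma> p q" "R n y p"
    then show "R n y q"
      unfolding R_def by (auto split: prod.splits intro: Qinf_le_trans)
  next
    fix n y z p assume p: "p \<in> Qinf H K" and Ry: "R n y p" and Rz: "R n z p"
    obtain i a where ia: "from_nat_into I n = (i, a)" by fastforce
    show "y = z"
    proof
      fix k
      \<comment> \<open>The stem of \<open>q\<close> is long enough to determine bit
        \<open>k\<close>, which then equals both \<open>y k\<close> and \<open>z k\<close>.\<close>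
      obtain q where "q \<in> Qinf H K" "Qinf_le H \<Sigma> p q" "m (Suc (i + k)) \<le> length (fst q)"
        using ex_long_extension[OF p] by blast
      then show "y k = z k" using Ry Rz ia unfolding R_def by auto
    qed
  next
    fix y :: "nat \<Rightarrow> bool" and p assume p: "p \<in> Qinf H K"
    let ?t = "snd p"
    obtain i0 where i0: "m_dn (?t 0) = m i0" using levels QinfD(1)[OF p] by blast
    have dn: "m_dn (?t n) = m (i0 + n)" for n
    proof (induction n)
      case (Suc n)
      obtain j where "m_dn (?t n) = m j" "m_up (?t n) = m (Suc j)"
        using levels QinfD(1)[OF p] by blast
      then show ?case
        using Suc QinfD(2)[OF p, of n] strict_mono_eq[OF m, of j "i0 + n"] by simp
    qed (simp add: i0)
    \<comment> \<open>Badness applies only above norm 4, so the first \<open>N\<close> creatures are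
      absorbed into the stem \<open>w\<close>.\<close>
    obtain N where N: "\<And>n. n \<ge> N \<Longrightarrow> nor (?t n) > 4"
      using QinfD(4)[OF p] unfolding filterlim_at_top_dense eventually_sequentially by meson
    obtain w where w: "w \<in> pos H (fst p) (map ?t [0..<N])" using pos_nonempty[OF p] by blast
    define i where "i = i0 + N"
    have dn': "m_dn (?t (n + N)) = m (i + n)" for n
      using dn[of "n + N"] by (simp add: i_def ac_simps)
    \<comment> \<open>All states are fixed before any creature is shrunk: the state at
      \<open>n\<close> depends on the original creature alone, and the shrinking at \<open>n\<close>
      has to aim at the state for \<open>Suc n\<close>.\<close>
    have "\<exists>a. a \<in> A (i + n) \<and> (\<forall>x \<in> A (Suc (i + n)) \<times> UNIV. \<exists>s\<in>\<Sigma> (?t (n + N)).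
              nor s \<ge> min (h (nor (?t (n + N)))) (h (real (i + n))) \<and>
              (\<forall>u\<in>seqs H (m (i + n)). \<forall>v\<in>pos H u [s]. F (i + n) a v = x))" for n
      using bad[rule_format, OF QinfD(1)[OF p], of "n + N" "i + n"] dn' N by auto
    then obtain a where a: "\<And>n. a n \<in> A (i + n)"
      and a_bad: "\<And>n x. x \<in> A (Suc (i + n)) \<times> UNIV \<Longrightarrow> \<exists>s\<in>\<Sigma> (?t (n + N)).
              nor s \<ge> min (h (nor (?t (n + N)))) (h (real (i + n))) \<and>
              (\<forall>u\<in>seqs H (m (i + n)). \<forall>v\<in>pos H u [s]. F (i + n) (a n) v = x)"
      by metis
    have "\<exists>s. s \<in> \<Sigma> (?t (n + N)) \<and>
        nor s \<ge> min (h (nor (?t (n + N)))) (h (real (i + n))) \<and>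
        (\<forall>u\<in>seqs H (m (i + n)). \<forall>v\<in>pos H u [s]. F (i + n) (a n) v = (a (Suc n), y n))" for n
      using a_bad[of "(a (Suc n), y n)" n] a[of "Suc n"] by auto
    then obtain s where s: "\<And>n. s n \<in> \<Sigma> (?t (n + N))"
      and nor_s: "\<And>n. nor (s n) \<ge> min (h (nor (?t (n + N)))) (h (real (i + n)))"
      and F_s: "\<And>n u v. u \<in> seqs H (m (i + n)) \<Longrightarrow> v \<in> pos H u [s n] \<Longrightarrow>
         F (i + n) (a n) v = (a (Suc n), y n)"
      by metis
    have h: "filterlim h at_top at_top" using mono_unbounded_at_top assms(3,4) .
    have lim1: "filterlim (\<lambda>n. h (nor (?t (n + N)))) at_top sequentially"
      using filterlim_compose[OF h filterlim_compose[OF QinfD(4)[OF p]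
            filterlim_add_const_nat_at_top]] .
    have lim2: "filterlim (\<lambda>n. h (real (i + n))) at_top sequentially"
      using filterlim_compose[OF h filterlim_compose[OF filterlim_real_sequentially
            filterlim_add_const_nat_at_top[of i]]] by (simp add: add.commute)
    \<comment> \<open>The norms dominate the minimum of two sequences tending to infinity.\<close>
    have lim: "filterlim (\<lambda>n. nor (s n)) at_top sequentially"
      unfolding filterlim_at_top
    proof
      fix Z
      show "eventually (\<lambda>n. Z \<le> nor (s n)) sequentially"
        using lim1[unfolded filterlim_at_top, rule_format, of Z]
          lim2[unfolded filterlim_at_top, rule_format, of Z]
        by eventually_elim (use nor_s in \<open>meson min.boundedI order_trans\<close>)
    qed
    let ?q = "(w, s)"
    note q = Qinf_pure_extension[OF p w s lim]
    have s_dn: "m_dn (s n) = m (i + n)" for n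
      using Sigma_levels[OF QinfD(1)[OF p] s] dn' by simp
    have s_up: "m_up (s n) = m (Suc (i + n))" for n
      using QinfD(2)[OF q(1), of n] s_dn[of "Suc n"] by simp
    have out: "bit F m i (a 0) (fst r) k = y k"
      if r: "Qinf_le H \<Sigma> ?q r" and k: "m (Suc (i + k)) \<le> length (fst r)" for r k
    proof -
      obtain l where l: "fst r \<in> seqs H (m (i + l))"
        "\<And>j. j < l \<Longrightarrow>
          (take (m (i + j)) (fst r), take (m (Suc (i + j))) (fst r)) \<in> val (s j)"
        using r[unfolded Qinf_le_iff[OF q(1)]] by (auto simp: s_dn)
      \<comment> \<open>A stem reaching level \<open>m (Suc (i + k))\<close> has passed through
        \<open>s k\<close>, and is therefore constrained by \<open>val (s k)\<close>.\<close>
      have "k < l"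
        using k l(1) strict_mono_less_eq[OF m, of "Suc (i + k)" "i + l"] by (simp add: seqs_def)
      have step: "F (i + j) (a j) (take (m (Suc (i + j))) (fst r)) = (a (Suc j), y j)"
        if "j < l" for j
      proof -
        have "m (i + j) \<le> m (Suc (i + j))" using strict_mono_less_eq[OF m] by simp
        note CR = CR_val[OF K_CR[OF QinfD(1)[OF q(1)]], of _ _ j, simplified, OF l(2)[OF that]]
        have "take (m (Suc (i + j))) (fst r) \<in> pos H (take (m (i + j)) (fst r)) [s j]"
          using CR l(2)[OF that] \<open>m (i + j) \<le> _\<close>
          by (simp add: pos_def s_dn s_up min_absorb1)
        then show ?thesis using F_s CR(1) s_dn by auto
      qed
      \<comment> \<open>By \<open>step\<close> the run passes exactly through the prescribed states,
        so bit \<open>k\<close> is the one emitted by \<open>s k\<close>.\<close>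
      have "j \<le> l \<Longrightarrow> state F m i (a 0) (fst r) j = a j" for j
        by (induction j) (auto simp: step)
      then show ?thesis using step[OF \<open>k < l\<close>] \<open>k < l\<close> by (simp add: bit_def)
    qed
    \<comment> \<open>The required \<open>n\<close> is an index of the start \<open>(i, a 0)\<close>
      in the enumeration of \<open>I\<close>.\<close>
    have "(i, a 0) \<in> I" using a[of 0] by (simp add: I_def)
    then obtain n where "from_nat_into I n = (i, a 0)"
      using from_nat_into_surj[OF I_countable] by blast
    then have "R n y ?q" unfolding R_def using out by simp
    then show "\<exists>q\<in>Qinf H K. Qinf_le H \<Sigma> p q \<and> (\<exists>n. R n y q)" using q by blast
  qed (rule Qinf_le_refl)
qed

end
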